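(* Let $X,Y$ be Banach spaces, let $E:X\to Y$ be a bounded linear operator, let $A:X\supset\operatorname{dom}A\to Y$ be a closed, densely defined linear operator, and suppose there is $\mu\in\mathbb{C}$ such that $\mu E-A$ maps $\operatorname{dom}A$ bijectively onto $Y$. Let $\mathcal{A}(\lambda)=\lambda E-A$, and let $\hat{\mathcal{A}}(\lambda)=\lambda\hat E-\hat A$ be of one of the following two forms, where $X'$ is the space of continuous linear functionals on $X$: (a) $\hat E=E+uv'$ and $\hat A=A+wv'$ for some $u,w\in Y$, $v'\in X'$; or (b) $\hat E=E+uv'$ and $\hat A=A+uw'$ for some $u\in Y$, $v',w'\in X'$. Suppose that $\hat{\mathcal{A}}$ is regular and that $w_k(E,A;\lambda)$ is finite for some $k\ge 1$ and some $\lambda\in\mathbb{C}\cup\{\infty\}$. Then, for this $k$ and $\lambda$, $$\left|w_k(\hat E,\hat A;\lambda)-w_k(E,A;\lambda)\right|\le 1,$$ $$\left|\dim\mathfrak{R}^k_\lambda(\hat E,\hat A)-\dim\mathfrak{R}^k_\lambda(E,A)\right|\le k.$$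
   Context: All vector spaces are complex. For $u\in Y$ and $v'\in X'$, $uv'$ denotes the operator $X\to Y$, $x\mapsto v'(x)u$. The operator $\hat A$ has domain $\operatorname{dom}\hat A=\operatorname{dom}A$. Regularity: for a pencil $\mathcal{A}(\lambda)=\lambda E-A$, a number $\mu\in\mathbb{C}$ is a resolvent point if $(\mu E-A)^{-1}$ exists and is a bounded operator defined on all of $Y$; $\infty$ is a resolvent point if $E$ has a bounded everywhere defined inverse and $A$ is bounded. The pencil is regular if it has at least one resolvent point in $\mathbb{C}\cup\{\infty\}$. Root subspaces: for $k\ge1$ and $\lambda\in\mathbb{C}$, $\mathfrak{R}^k_\lambda(E,A)$ is the set of all $x\in\operatorname{dom}A$ such that there are $x_1,\dots,x_k\in\operatorname{dom}A$ with $x_k=x$ and $(A-\lambda E)x_1=0,\ (A-\lambda E)x_2=Ex_1,\ \dots,\ (A-\lambda E)x_k=Ex_{k-1}$. For $\lambda=\infty$, $\mathfrak{R}^k_\infty(E,A)$ is the set of all $x\in\operatorname{dom}A$ such that there are $x_1,\dots,x_k\in\operatorname{dom}A$ with $x_k=x$ and $Ex_1=0,\ Ex_2=Ax_1,\ \dots,\ Ex_k=Ax_{k-1}$. Put $\mathfrak{R}^0_\lambda(E,A)=\{0\}$. Weyr characteristic: for $k\ge1$ and $\lambda\in\mathbb{C}\cup\{\infty\}$, $w_k(E,A;\lambda)=\dim\big(\mathfrak{R}^k_\lambda(E,A)/\mathfrak{R}^{k-1}_\lambda(E,A)\big)$. (Equivalently this is the Weyr characteristic of the linear relation $\{(x,z)\in\operatorname{dom}A\times\operatorname{dom}A: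 Ax=Ez\}$, whose root subspaces coincide with the $\mathfrak{R}^k_\lambda(E,A)$.) The same definitions apply to $(\hat E,\hat A)$. Dimensions take values in $\{0,1,2,\dots\}\cup\{\infty\}$; an inequality $|a-b|\le c$ with $c$ finite between such values is read as $a\le b+c$ and $b\le a+c$. *)

theory Defs
  imports "HOL-Analysis.Analysis" "HOL-Library.Extended_Nat"
begin

section \<open>Complex Banach spaces\<close>

text \<open>The library only has real normed spaces. A complex normed space is a real one with a
  multiplication by complex scalars that extends the real scaling.\<close>

class complex_normed_vector = real_normed_vector +
  fixes scaleC :: "complex \<Rightarrow> 'a \<Rightarrow> 'a" (infixr "*\<^sub>C" 75)
  assumes scaleC_add_right: "a *\<^sub>C (x + y) = a *\<^sub>C x + a *\<^sub>C y"
    and scaleC_add_left: "(a + b) *\<^sub>C x = a *\<^sub>C x + b *\<^sub>C x"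
    and scaleC_scaleC: "a *\<^sub>C (b *\<^sub>C x) = (a * b) *\<^sub>C x"
    and scaleC_of_real: "complex_of_real r *\<^sub>C x = r *\<^sub>R x"
    and norm_scaleC: "norm (a *\<^sub>C x) = cmod a * norm x"

class complex_banach = complex_normed_vector + banach

instantiation complex :: complex_banach
begin

definition scaleC_complex :: "complex \<Rightarrow> complex \<Rightarrow> complex" where
  "scaleC_complex a z = a * z"

instance
  by standard (auto simp: scaleC_complex_def algebra_simps norm_mult scaleR_conv_of_real)

end

lemma scaleC_one: "1 *\<^sub>C x = x" for x :: "'a::complex_normed_vector"
  using scaleC_of_real[of 1 x] by simp

global_interpretation complex_vector:
  vector_space "scaleC :: complex \<Rightarrow> 'a \<Rightarrow> 'a::complex_normed_vector"
  by standard (auto simp: scaleC_add_right scaleC_add_left scaleC_scaleC scaleC_one)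

text \<open>Everywhere defined bounded operators; with codomain \<^typ>\<open>complex\<close> these are the elements
  of the dual space.\<close>

definition bounded_clinear ::
  "('a::complex_normed_vector \<Rightarrow> 'b::complex_normed_vector) \<Rightarrow> bool" where
  "bounded_clinear f \<longleftrightarrow> bounded_linear f \<and> (\<forall>c x. f (c *\<^sub>C x) = c *\<^sub>C f x)"


section \<open>Dimensions with values in the extended naturals\<close>

definition edim :: "'a::complex_normed_vector set \<Rightarrow> enat" where
  "edim V = (if \<exists>B. finite B \<and> V \<subseteq> complex_vector.span B
             then enat (complex_vector.dim V) else \<infinity>)"

text \<open>The quotient \<open>V/U\<close> is handled through representatives: a finite set \<open>B \<subseteq> V\<close> is a basis of \<open>V\<close>
  modulo \<open>U\<close> if the classes of its elements are pairwise distinct and form a basis of \<open>V/U\<close>.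
  (A linear combination of classes vanishes iff the same combination of the representatives lies
  in \<open>U\<close>.)\<close>

definition basis_mod ::
  "'a::complex_normed_vector set \<Rightarrow> 'a set \<Rightarrow> 'a set \<Rightarrow> bool" where
  "basis_mod V U B \<longleftrightarrow> finite B \<and> B \<subseteq> V \<and>
     (\<forall>c. (\<Sum>b\<in>B. c b *\<^sub>C b) \<in> U \<longrightarrow> (\<forall>b\<in>B. c b = 0)) \<and>
     (\<forall>v\<in>V. \<exists>c. v - (\<Sum>b\<in>B. c b *\<^sub>C b) \<in> U)"

text \<open>All finite bases of \<open>V/U\<close> have the same cardinality, and the infimum of the empty set is
  \<open>\<infinity>\<close>.\<close>

definition quotient_dim ::
  "'a::complex_normed_vector set \<Rightarrow> 'a set \<Rightarrow> enat" where
  "quotient_dim V U = (INF B \<in> {B. basis_mod V U B}. enat (card B))"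

text \<open>Consistency check: whenever \<open>V/U\<close> is realised as the image of \<open>V\<close> under a linear map with
  kernel \<open>U\<close> on \<open>V\<close>, the two notions of dimension agree. In particular \<open>quotient_dim V {0}\<close> is
  \<open>edim V\<close>.\<close>

lemma basis_mod_card_image:
  fixes f :: "'a::complex_normed_vector \<Rightarrow> 'b::complex_normed_vector"
  assumes f: "Vector_Spaces.linear scaleC scaleC f" and V: "complex_vector.subspace V"
    and B: "basis_mod V {x \<in> V. f x = 0} B"
  shows "edim (f ` V) = enat (card B)"
proof -
  interpret f: Vector_Spaces.linear scaleC scaleC f by (rule f)
  have fin: "finite B" and BV: "B \<subseteq> V"
    and ind: "\<And>c b. (\<Sum>b\<in>B. c b *\<^sub>C b) \<in> {x \<in> V. f x = 0} \<Longrightarrow> b \<in> B \<Longrightarrow> c b = 0"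
    and spn: "\<And>v. v \<in> V \<Longrightarrow> \<exists>c. v - (\<Sum>b\<in>B. c b *\<^sub>C b) \<in> {x \<in> V. f x = 0}"
    using B unfolding basis_mod_def by blast+
  have inV: "(\<Sum>b\<in>B. c b *\<^sub>C b) \<in> V" for c
    using BV V by (intro complex_vector.subspace_sum complex_vector.subspace_scale) auto
  have fsum: "f (\<Sum>b\<in>B. c b *\<^sub>C b) = (\<Sum>b\<in>B. c b *\<^sub>C f b)" for c
    by (simp add: f.sum f.scale)
  have inj: "inj_on f B"
  proof (rule inj_onI, rule ccontr)
    fix b b' assume bb: "b \<in> B" "b' \<in> B" "f b = f b'" "b \<noteq> b'"
    define c :: "'a \<Rightarrow> complex" where "c = (\<lambda>x. (if x = b then 1 else 0) - (if x = b' then 1 else 0))"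
    have "(\<Sum>x\<in>B. c x *\<^sub>C f x) = (\<Sum>x\<in>B. (if x = b then f x else 0) - (if x = b' then f x else 0))"
      by (rule sum.cong) (auto simp: c_def complex_vector.scale_left_diff_distrib)
    also have "\<dots> = 0"
      using bb fin by (simp add: sum_subtractf)
    finally have "c b = 0"
      using ind[of c b] inV[of c] fsum[of c] bb by simp
    then show False using bb by (simp add: c_def)
  qed
  have indep: "\<not> complex_vector.dependent (f ` B)"
  proof (rule complex_vector.independent_if_scalars_zero)
    show "finite (f ` B)" using fin by simp
    fix d x assume d: "(\<Sum>x\<in>f ` B. d x *\<^sub>C x) = 0" and x: "x \<in> f ` B"
    then obtain b where b: "b \<in> B" "x = f b" by blast
    have "f (\<Sum>b\<in>B. d (f b) *\<^sub>C b) = 0"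
      using d inj by (simp add: fsum sum.reindex)
    then show "d x = 0"
      using ind[of "\<lambda>b. d (f b)" b] inV b by simp
  qed
  have span: "f ` V \<subseteq> complex_vector.span (f ` B)"
  proof
    fix y assume "y \<in> f ` V"
    then obtain v where v: "v \<in> V" "y = f v" by blast
    obtain c where "f (v - (\<Sum>b\<in>B. c b *\<^sub>C b)) = 0" using spn[OF v(1)] by blast
    then have "y = (\<Sum>b\<in>B. c b *\<^sub>C f b)" using v by (simp add: f.diff fsum)
    then show "y \<in> complex_vector.span (f ` B)"
      by (simp add: complex_vector.span_sum complex_vector.span_scale complex_vector.span_base)
  qed
  have "complex_vector.dim (f ` V) = card (f ` B)"
    using BV indep span by (intro complex_vector.dim_unique) auto
  moreover have "\<exists>B. finite B \<and> f ` V \<subseteq> complex_vector.span B"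
    using fin span by blast
  ultimately show ?thesis
    using inj by (simp add: edim_def card_image)
qed

lemma quotient_dim_eq_edim_image:
  fixes f :: "'a::complex_normed_vector \<Rightarrow> 'b::complex_normed_vector"
  assumes f: "Vector_Spaces.linear scaleC scaleC f" and V: "complex_vector.subspace V"
  shows "quotient_dim V {x \<in> V. f x = 0} = edim (f ` V)"
proof (cases "\<exists>B. basis_mod V {x \<in> V. f x = 0} B")
  case True
  then have "{B. basis_mod V {x \<in> V. f x = 0} B} \<noteq> {}" by blast
  moreover have "enat (card B) = edim (f ` V)" if "B \<in> {B. basis_mod V {x \<in> V. f x = 0} B}" for B
    using that basis_mod_card_image[OF f V] by simp
  ultimately show ?thesis
    unfolding quotient_dim_def by (rule INF_eq_const)
next
  case False
  interpret f: Vector_Spaces.linear scaleC scaleC f by (rule f)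
  have "\<not> (\<exists>W. finite W \<and> f ` V \<subseteq> complex_vector.span W)"
  proof
    assume "\<exists>W. finite W \<and> f ` V \<subseteq> complex_vector.span W"
    then obtain W where W: "finite W" "f ` V \<subseteq> complex_vector.span W" by blast
    obtain C where C: "C \<subseteq> f ` V" "\<not> complex_vector.dependent C" "f ` V \<subseteq> complex_vector.span C"
      by (rule complex_vector.basis_exists)
    have finC: "finite C"
      using complex_vector.independent_span_bound[OF W(1) C(2) subset_trans[OF C(1) W(2)]] by simp
    define g where "g = inv_into V f"
    have g: "g y \<in> V \<and> f (g y) = y" if "y \<in> C" for y
      using that C(1) unfolding g_def by (blast intro: inv_into_into f_inv_into_f)
    have injg: "inj_on g C" using g by (intro inj_on_inverseI[of C f]) simp
    have sumg: "(\<Sum>b\<in>g ` C. c b *\<^sub>C b) = (\<Sum>y\<in>C. c (g y) *\<^sub>C g y)" for c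
      using injg by (simp add: sum.reindex)
    have fsumg: "f (\<Sum>y\<in>C. c y *\<^sub>C g y) = (\<Sum>y\<in>C. c y *\<^sub>C y)" for c
      using g by (simp add: f.sum f.scale)
    have "basis_mod V {x \<in> V. f x = 0} (g ` C)"
      unfolding basis_mod_def
    proof (intro conjI allI ballI impI)
      show "finite (g ` C)" "g ` C \<subseteq> V" using finC g by auto
    next
      fix c b assume "(\<Sum>b\<in>g ` C. c b *\<^sub>C b) \<in> {x \<in> V. f x = 0}" and b: "b \<in> g ` C"
      then have 0: "(\<Sum>y\<in>C. c (g y) *\<^sub>C y) = 0"
        using fsumg[of "\<lambda>y. c (g y)"] by (simp add: sumg)
      have "\<forall>y\<in>C. c (g y) = 0"
      proof (rule ccontr)
        assume "\<not> ?thesis"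
        then have "complex_vector.dependent C"
          using 0 by (subst complex_vector.dependent_finite[OF finC])
            (intro exI[of _ "\<lambda>y. c (g y)"], simp)
        with C(2) show False by contradiction
      qed
      then show "c b = 0" using b by force
    next
      fix v assume v: "v \<in> V"
      then have "f v \<in> complex_vector.span C" using C(3) by blast
      then obtain d where d: "f v = (\<Sum>y\<in>C. d y *\<^sub>C y)"
        unfolding complex_vector.span_finite[OF finC] by (elim rangeE)
      define c where "c = (\<lambda>b. d (f b))"
      have eq: "(\<Sum>b\<in>g ` C. c b *\<^sub>C b) = (\<Sum>y\<in>C. d y *\<^sub>C g y)"
        using g by (simp add: sumg c_def)
      have "(\<Sum>y\<in>C. d y *\<^sub>C g y) \<in> V"
        using g V by (intro complex_vector.subspace_sum complex_vector.subspace_scale) auto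
      then have "v - (\<Sum>b\<in>g ` C. c b *\<^sub>C b) \<in> {x \<in> V. f x = 0}"
        using v V d by (simp add: eq f.diff fsumg complex_vector.subspace_diff)
      then show "\<exists>c. v - (\<Sum>b\<in>g ` C. c b *\<^sub>C b) \<in> {x \<in> V. f x = 0}" by blast
    qed
    with False show False by blast
  qed
  then have "edim (f ` V) = \<infinity>" by (simp add: edim_def)
  moreover have "quotient_dim V {x \<in> V. f x = 0} = \<infinity>"
    using False by (simp add: quotient_dim_def top_enat_def)
  ultimately show ?thesis by simp
qed

lemma quotient_dim_zero:
  assumes "complex_vector.subspace V"
  shows "quotient_dim V {0} = edim V"
proof -
  have "{x \<in> V. x = 0} = {0}" using complex_vector.subspace_0[OF assms] by auto
  then show ?thesis
    using quotient_dim_eq_edim_image[OF complex_vector.linear_ident assms] by simp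
qed


section \<open>Operators with a domain\<close>

text \<open>A partially defined operator is a pair of a domain \<open>D\<close> and a total function \<open>A\<close>, whose values
  outside \<open>D\<close> are irrelevant.\<close>

definition linear_operator ::
  "'a::complex_normed_vector set \<Rightarrow> ('a \<Rightarrow> 'b::complex_normed_vector) \<Rightarrow> bool" where
  "linear_operator D A \<longleftrightarrow> complex_vector.subspace D \<and>
     (\<forall>x\<in>D. \<forall>y\<in>D. A (x + y) = A x + A y) \<and> (\<forall>c. \<forall>x\<in>D. A (c *\<^sub>C x) = c *\<^sub>C A x)"

definition closed_operator ::
  "'a::complex_normed_vector set \<Rightarrow> ('a \<Rightarrow> 'b::complex_normed_vector) \<Rightarrow> bool" where
  "closed_operator D A \<longleftrightarrow> closed {(x, A x) |x. x \<in> D}"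

definition densely_defined :: "'a::complex_normed_vector set \<Rightarrow> bool" where
  "densely_defined D \<longleftrightarrow> closure D = UNIV"


section \<open>Operator pencils\<close>

datatype extended_complex = Finite complex | Infinity

text \<open>In what follows, \<open>E D A\<close> stands for the pencil \<open>\<lambda>E - A\<close> with \<open>dom A = D\<close>.\<close>

definition resolvent_point ::
  "('a::complex_normed_vector \<Rightarrow> 'b::complex_normed_vector) \<Rightarrow> 'a set \<Rightarrow> ('a \<Rightarrow> 'b)
     \<Rightarrow> extended_complex \<Rightarrow> bool" where
  "resolvent_point E D A l = (case l of
       Finite \<mu> \<Rightarrow> bij_betw (\<lambda>x. \<mu> *\<^sub>C E x - A x) D UNIV \<and>
                  bounded_clinear (the_inv_into D (\<lambda>x. \<mu> *\<^sub>C E x - A x))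
     | Infinity \<Rightarrow> bij E \<and> bounded_clinear (inv E) \<and> (\<exists>K. \<forall>x\<in>D. norm (A x) \<le> K * norm x))"

definition regular_pencil ::
  "('a::complex_normed_vector \<Rightarrow> 'b::complex_normed_vector) \<Rightarrow> 'a set \<Rightarrow> ('a \<Rightarrow> 'b) \<Rightarrow> bool" where
  "regular_pencil E D A \<longleftrightarrow> (\<exists>l. resolvent_point E D A l)"

definition root_chain ::
  "('a::complex_normed_vector \<Rightarrow> 'b::complex_normed_vector) \<Rightarrow> 'a set \<Rightarrow> ('a \<Rightarrow> 'b)
     \<Rightarrow> extended_complex \<Rightarrow> nat \<Rightarrow> (nat \<Rightarrow> 'a) \<Rightarrow> bool" where
  "root_chain E D A l k x \<longleftrightarrow> (\<forall>j\<in>{1..k}. x j \<in> D) \<and>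
     (\<forall>j\<in>{1..k}. case l of
         Finite \<mu> \<Rightarrow> A (x j) - \<mu> *\<^sub>C E (x j) = (if j = 1 then 0 else E (x (j - 1)))
       | Infinity \<Rightarrow> E (x j) = (if j = 1 then 0 else A (x (j - 1))))"

definition root_space ::
  "('a::complex_normed_vector \<Rightarrow> 'b::complex_normed_vector) \<Rightarrow> 'a set \<Rightarrow> ('a \<Rightarrow> 'b)
     \<Rightarrow> extended_complex \<Rightarrow> nat \<Rightarrow> 'a set" where
  "root_space E D A l k = (if k = 0 then {0} else {x k |x. root_chain E D A l k x})"

definition weyr ::
  "('a::complex_normed_vector \<Rightarrow> 'b::complex_normed_vector) \<Rightarrow> 'a set \<Rightarrow> ('a \<Rightarrow> 'b)
     \<Rightarrow> extended_complex \<Rightarrow> nat \<Rightarrow> enat" where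
  "weyr E D A l k = quotient_dim (root_space E D A l k) (root_space E D A l (k - 1))"

end

theory Submission
  imports Defs
begin

text \<open>
  The statement is one of linear algebra. For finite \<open>\<lambda>\<close> put \<open>S = A - \<lambda>E\<close> and \<open>T = E\<close>, for
  \<open>\<lambda> = \<infinity>\<close> put \<open>S = E\<close> and \<open>T = A\<close>. In both cases the root subspace \<open>R\<^sup>k\<close> consists of the ends
  \<open>x\<^sub>k\<close> of the chains \<open>S x\<^sub>j = T x\<^sub>j\<^sub>-\<^sub>1\<close> with \<open>x\<^sub>0 = 0\<close>, the perturbed pair \<open>(S', T')\<close> is again a
  perturbation of \<open>(S, T)\<close> of one of the two forms, and a resolvent point makes some combination
  \<open>\<alpha>S + \<beta>T\<close> injective (\<open>injective_pencil\<close>). As the roles of the two pencils can be exchanged, it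
  suffices to bound \<open>dim R\<^sup>k/R\<^sup>k\<^sup>-\<^sup>1\<close> by \<open>dim R'\<^sup>k/R'\<^sup>k\<^sup>-\<^sup>1 + 1\<close>, where \<open>R'\<close> belongs to \<open>(S', T')\<close>.

  Let \<open>C\<close> be the space of ends of the chains of length \<open>k\<close> that both pencils have in common. Two
  facts carry the proof. First, \<open>C + R\<^sup>k\<^sup>-\<^sup>1\<close> has codimension at most one in \<open>R\<^sup>k\<close>: a chain can
  fail to be common only by violating a scalar condition at some index, shifting
  the chain shifts the violations along with it, and so shifted copies of a single chain correct all others
  (\<open>unviolated_chains_codim_one\<close>). Second, \<open>C \<inter> R'\<^sup>k\<^sup>-\<^sup>1 \<subseteq> R\<^sup>k\<^sup>-\<^sup>1\<close>, because a pencil with an injective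
  combination has no nonzero chain that runs from \<open>0\<close> back to \<open>0\<close> (\<open>chain_ending_in_zero\<close>).
  Hence \<open>dim R\<^sup>k/R\<^sup>k\<^sup>-\<^sup>1 \<le> dim C/(C \<inter> R\<^sup>k\<^sup>-\<^sup>1) + 1 \<le> dim C/(C \<inter> R'\<^sup>k\<^sup>-\<^sup>1) + 1\<close>, and \<open>C/(C \<inter> R'\<^sup>k\<^sup>-\<^sup>1)\<close>
  embeds into \<open>R'\<^sup>k/R'\<^sup>k\<^sup>-\<^sup>1\<close> (\<open>quotient_dim_le_Suc\<close>). The bound on \<open>dim R\<^sup>k\<close> is the sum of these
  inequalities over \<open>1, \<dots>, k\<close>.
\<close>

section \<open>Dimensions\<close>

lemma edim_le_iff:
  fixes V :: "'a::complex_normed_vector set"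
  shows "edim V \<le> enat n \<longleftrightarrow> (\<exists>B. finite B \<and> card B \<le> n \<and> V \<subseteq> complex_vector.span B)"
proof
  assume le: "edim V \<le> enat n"
  then obtain W where W: "finite W" "V \<subseteq> complex_vector.span W"
    by (auto simp: edim_def split: if_splits)
  then have "edim V = enat (complex_vector.dim V)"
    unfolding edim_def by auto
  with le have dim: "complex_vector.dim V \<le> n" by simp
  obtain B where B: "B \<subseteq> V" "\<not> complex_vector.dependent B" "V \<subseteq> complex_vector.span B"
      "card B = complex_vector.dim V"
    by (rule complex_vector.basis_exists)
  have "finite B"
    using complex_vector.independent_span_bound[OF W(1) B(2)] B(1) W(2) by auto
  with B dim show "\<exists>B. finite B \<and> card B \<le> n \<and> V \<subseteq> complex_vector.span B" by auto
next
  assume "\<exists>B. finite B \<and> card B \<le> n \<and> V \<subseteq> complex_vector.span B"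
  then obtain B where B: "finite B" "card B \<le> n" "V \<subseteq> complex_vector.span B" by blast
  then have "edim V = enat (complex_vector.dim V)"
    unfolding edim_def by auto
  with complex_vector.dim_le_card[OF B(3,1)] B(2) show "edim V \<le> enat n" by simp
qed

lemma edim_finite_basis:
  fixes V :: "'a::complex_normed_vector set"
  assumes "edim V = enat n"
  obtains B where "finite B" "card B \<le> n" "B \<subseteq> V" "V \<subseteq> complex_vector.span B"
proof -
  obtain W where W: "finite W" "V \<subseteq> complex_vector.span W"
    using assms by (auto simp: edim_def split: if_splits)
  then have "edim V = enat (complex_vector.dim V)" unfolding edim_def by auto
  then have dim: "complex_vector.dim V = n" using assms by simp
  obtain B where B: "B \<subseteq> V" "\<not> complex_vector.dependent B" "V \<subseteq> complex_vector.span B"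
      "card B = complex_vector.dim V"
    by (rule complex_vector.basis_exists)
  have "finite B"
    using complex_vector.independent_span_bound[OF W(1) B(2)] B(1) W(2) by auto
  with B dim that show thesis by auto
qed

lemma edim_mono:
  assumes "V \<subseteq> W"
  shows "edim V \<le> edim W"
proof (cases "edim W")
  case (enat n)
  then have "edim W \<le> enat n" by simp
  then show ?thesis using assms enat unfolding edim_le_iff by (metis edim_le_iff subset_trans)
qed simp

lemma edim_insert_le:
  assumes "V \<subseteq> complex_vector.span (insert x W)"
  shows "edim V \<le> edim W + 1"
proof (cases "edim W")
  case (enat n)
  then obtain B where B: "finite B" "card B \<le> n" "W \<subseteq> complex_vector.span B"
    by (metis edim_finite_basis)
  have "insert x W \<subseteq> complex_vector.span (insert x B)"
    using B(3) complex_vector.span_mono[of B "insert x B"]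
    by (auto intro: complex_vector.span_base)
  then have "V \<subseteq> complex_vector.span (insert x B)"
    using assms complex_vector.span_minimal[OF _ complex_vector.subspace_span] by blast
  moreover have "card (insert x B) \<le> Suc n"
    using B(1,2) by (simp add: card_insert_if)
  ultimately have "edim V \<le> enat (Suc n)"
    unfolding edim_le_iff using B(1) by blast
  then show ?thesis by (simp add: enat one_enat_def)
qed simp

lemma edim_span_independent:
  fixes B :: "'a::complex_normed_vector set"
  assumes "\<not> complex_vector.dependent B"
  shows "edim (complex_vector.span B) = (if finite B then enat (card B) else \<infinity>)"
proof (cases "finite B")
  case True
  then show ?thesis
    using complex_vector.dim_span_eq_card_independent[OF assms] by (auto simp: edim_def)
next
  case False
  then have "\<not> (\<exists>W. finite W \<and> complex_vector.span B \<subseteq> complex_vector.span W)"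
    using complex_vector.independent_span_bound[OF _ assms] complex_vector.span_superset[of B]
    by blast
  then show ?thesis using False by (simp add: edim_def)
qed

text \<open>The map projects onto the part of a basis of \<open>V\<close> that is left over after a basis of \<open>U\<close>. It
  stands in for the quotient map \<open>V \<rightarrow> V/U\<close>, for which there is no type.\<close>

lemma linear_map_with_kernel:
  fixes U V :: "'a::complex_normed_vector set"
  assumes U: "complex_vector.subspace U" and V: "complex_vector.subspace V" and UV: "U \<subseteq> V"
  obtains f :: "'a \<Rightarrow> 'a"
    where "Vector_Spaces.linear scaleC scaleC f" "{x \<in> V. f x = 0} = U"
      "edim V = edim U + edim (f ` V)"
proof -
  interpret vs: vector_space_pair "scaleC :: complex \<Rightarrow> 'a \<Rightarrow> 'a" "scaleC :: complex \<Rightarrow> 'a \<Rightarrow> 'a" ..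
  obtain BU where BU: "BU \<subseteq> U" "\<not> complex_vector.dependent BU" "U \<subseteq> complex_vector.span BU"
    by (rule complex_vector.basis_exists)
  obtain BV where BV: "BU \<subseteq> BV" "BV \<subseteq> V" "\<not> complex_vector.dependent BV"
      "V \<subseteq> complex_vector.span BV"
    using complex_vector.maximal_independent_subset_extend[OF subset_trans[OF BU(1) UV] BU(2)]
    by blast
  define N where "N = BV - BU"
  have indN: "\<not> complex_vector.dependent N"
    using BV(3) complex_vector.dependent_mono unfolding N_def by blast
  have spU: "complex_vector.span BU = U"
    using BU U complex_vector.span_subspace by blast
  have spV: "complex_vector.span BV = V"
    using BV V complex_vector.span_subspace by blast
  define f where "f = vs.construct BV (\<lambda>b. if b \<in> BU then 0 else b)"
  have lin: "Vector_Spaces.linear scaleC scaleC f"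
    unfolding f_def by (rule vs.linear_construct[OF BV(3)])
  interpret f: Vector_Spaces.linear scaleC scaleC f by (rule lin)
  have basis: "f b = (if b \<in> BU then 0 else b)" if "b \<in> BV" for b
    unfolding f_def by (rule vs.construct_basis[OF BV(3) that])
  have f0: "f x = 0" if "x \<in> U" for x
  proof (rule vs.linear_eq_0_on_span[OF lin])
    show "x \<in> complex_vector.span BU" using that spU by simp
    show "f b = 0" if "b \<in> BU" for b using basis[of b] BV(1) that by auto
  qed
  have fid: "f x = x" if "x \<in> complex_vector.span N" for x
    by (rule vs.linear_eq_on[OF lin complex_vector.linear_ident that])
      (auto simp: basis N_def)
  have split: "\<exists>a\<in>U. \<exists>b\<in>complex_vector.span N. x = a + b" if "x \<in> V" for x
  proof -
    have "BV = BU \<union> N" using BV(1) by (auto simp: N_def)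
    then have "x \<in> complex_vector.span (BU \<union> N)" using that spV by simp
    then show ?thesis unfolding complex_vector.span_Un spU by blast
  qed
  have NV: "complex_vector.span N \<subseteq> V"
    using complex_vector.span_mono[of N BV] spV by (auto simp: N_def)
  have ker: "{x \<in> V. f x = 0} = U"
  proof
    show "{x \<in> V. f x = 0} \<subseteq> U"
    proof
      fix x assume "x \<in> {x \<in> V. f x = 0}"
      then obtain a b where "a \<in> U" "b \<in> complex_vector.span N" "x = a + b" "f x = 0"
        using split by blast
      then show "x \<in> U" using f0[of a] fid[of b] by (simp add: f.add)
    qed
  qed (use f0 UV in auto)
  have "f ` V = complex_vector.span N"
  proof
    show "f ` V \<subseteq> complex_vector.span N"
    proof
      fix y assume "y \<in> f ` V"
      then obtain a b where "a \<in> U" "b \<in> complex_vector.span N" "y = f (a + b)"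
        using split by blast
      then show "y \<in> complex_vector.span N" using f0[of a] fid[of b] by (simp add: f.add)
    qed
    show "complex_vector.span N \<subseteq> f ` V"
    proof
      fix y assume "y \<in> complex_vector.span N"
      then show "y \<in> f ` V" using NV fid[of y] by (metis imageI subsetD)
    qed
  qed
  then have "edim (f ` V) = (if finite N then enat (card N) else \<infinity>)"
    by (simp add: edim_span_independent[OF indN])
  moreover have "edim U = (if finite BU then enat (card BU) else \<infinity>)"
    using edim_span_independent[OF BU(2)] spU by simp
  moreover have "edim V = (if finite BV then enat (card BV) else \<infinity>)"
    using edim_span_independent[OF BV(3)] spV by simp
  moreover have "card BV = card BU + card N" if "finite BV"
    using that BV(1) unfolding N_def
    by (metis card_Diff_subset card_mono finite_subset le_add_diff_inverse)
  moreover have "finite BV \<longleftrightarrow> finite BU \<and> finite N"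
    using BV(1) unfolding N_def by (metis finite_Diff2 finite_subset)
  ultimately have "edim V = edim U + edim (f ` V)" by simp
  with lin ker that show thesis by blast
qed

lemma edim_eq_edim_add_quotient_dim:
  assumes "complex_vector.subspace U" "complex_vector.subspace V" "U \<subseteq> V"
  shows "edim V = edim U + quotient_dim V U"
  by (metis assms linear_map_with_kernel quotient_dim_eq_edim_image)

lemma edim_image_le_of_kernel_le:
  fixes f :: "'a::complex_normed_vector \<Rightarrow> 'b::complex_normed_vector"
    and g :: "'a \<Rightarrow> 'c::complex_normed_vector"
  assumes f: "Vector_Spaces.linear scaleC scaleC f" and g: "Vector_Spaces.linear scaleC scaleC g"
    and C: "complex_vector.subspace C"
    and ker: "\<And>x. x \<in> C \<Longrightarrow> g x = 0 \<Longrightarrow> f x = 0"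
  shows "edim (f ` C) \<le> edim (g ` C)"
proof (cases "edim (g ` C)")
  case (enat n)
  interpret f: Vector_Spaces.linear scaleC scaleC f by (rule f)
  interpret g: Vector_Spaces.linear scaleC scaleC g by (rule g)
  obtain B where B: "finite B" "card B \<le> n" "B \<subseteq> g ` C" "g ` C \<subseteq> complex_vector.span B"
    using edim_finite_basis[OF enat] by blast
  then obtain P where P: "P \<subseteq> C" "B = g ` P" "inj_on g P"
    by (metis subset_image_inj)
  have "f ` C \<subseteq> complex_vector.span (f ` P)"
  proof
    fix y assume "y \<in> f ` C"
    then obtain x where x: "x \<in> C" "y = f x" by blast
    have "g x \<in> g ` complex_vector.span P"
      using B(4) x(1) P(2) by (auto simp: g.span_image)
    then obtain p where p: "p \<in> complex_vector.span P" "g x = g p" by blast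
    have "p \<in> C" using p(1) complex_vector.span_minimal[OF P(1) C] by blast
    then have "f (x - p) = 0"
      using x(1) p(2) C by (intro ker) (auto simp: g.diff complex_vector.subspace_diff)
    then show "y \<in> complex_vector.span (f ` P)"
      using p(1) x(2) by (auto simp: f.diff f.span_image)
  qed
  moreover have "finite P" "card P \<le> n"
    using B(1,2) P(2,3) by (auto simp: finite_image_iff card_image)
  ultimately have "edim (f ` C) \<le> enat n"
    unfolding edim_le_iff by (meson card_image_le finite_imageI order_trans)
  then show ?thesis by (simp add: enat)
qed simp

text \<open>The inclusions of \<open>C\<close> induce maps \<open>C/(C \<inter> U') \<rightarrow> V'/U'\<close>, which is injective, and
  \<open>C/(C \<inter> U') \<rightarrow> V/U\<close>, whose image has codimension at most one.\<close>

lemma quotient_dim_le_Suc: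
  fixes U V U' V' C :: "'a::complex_normed_vector set"
  assumes V: "complex_vector.subspace U" "complex_vector.subspace V" "U \<subseteq> V"
    and V': "complex_vector.subspace U'" "complex_vector.subspace V'" "U' \<subseteq> V'"
    and C: "complex_vector.subspace C" "C \<subseteq> V'" "C \<subseteq> V" "C \<inter> U' \<subseteq> U"
    and codim: "\<And>v. v \<in> V \<Longrightarrow> \<exists>c\<in>C. \<exists>t. v - c - t *\<^sub>C p \<in> U"
  shows "quotient_dim V U \<le> quotient_dim V' U' + 1"
proof -
  obtain f :: "'a \<Rightarrow> 'a" where f: "Vector_Spaces.linear scaleC scaleC f" "{x \<in> V. f x = 0} = U"
    using linear_map_with_kernel[OF V] by blast
  obtain g :: "'a \<Rightarrow> 'a" where g: "Vector_Spaces.linear scaleC scaleC g" "{x \<in> V'. g x = 0} = U'"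
    using linear_map_with_kernel[OF V'] by blast
  interpret f: Vector_Spaces.linear scaleC scaleC f by (rule f)
  have "f ` V \<subseteq> complex_vector.span (insert (f p) (f ` C))"
  proof
    fix y assume "y \<in> f ` V"
    then obtain v where v: "v \<in> V" "y = f v" by blast
    obtain c t where ct: "c \<in> C" "v - c - t *\<^sub>C p \<in> U" using codim[OF v(1)] by blast
    then have "f (v - c - t *\<^sub>C p) = 0" using f(2) by blast
    then have "y = f c + t *\<^sub>C f p" using v(2) by (simp add: f.diff f.scale diff_eq_eq add.commute)
    then show "y \<in> complex_vector.span (insert (f p) (f ` C))"
      using ct(1) by (auto intro!: complex_vector.span_add complex_vector.span_scale
          intro: complex_vector.span_base)
  qed
  then have "edim (f ` V) \<le> edim (f ` C) + 1" by (rule edim_insert_le)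
  also have "edim (f ` C) \<le> edim (g ` C)"
    using C f(2) g(2) by (intro edim_image_le_of_kernel_le[OF f(1) g(1) C(1)]) blast
  also have "edim (g ` C) \<le> edim (g ` V')"
    using C(2) by (intro edim_mono image_mono)
  finally show ?thesis
    using quotient_dim_eq_edim_image[OF f(1) V(2)] quotient_dim_eq_edim_image[OF g(1) V'(2)]
    by (simp add: f(2) g(2))
qed


section \<open>Linear operators on a subspace\<close>

lemma linear_operatorD:
  assumes "linear_operator D S"
  shows "complex_vector.subspace D"
    and "x \<in> D \<Longrightarrow> y \<in> D \<Longrightarrow> S (x + y) = S x + S y"
    and "x \<in> D \<Longrightarrow> S (c *\<^sub>C x) = c *\<^sub>C S x"
  using assms unfolding linear_operator_def by auto

lemma linear_operator_zero:
  assumes "linear_operator D S"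
  shows "S 0 = 0"
  using linear_operatorD(3)[OF assms, of 0 0] complex_vector.subspace_0[OF linear_operatorD(1)[OF assms]]
  by simp

lemma linear_operator_comb:
  assumes "linear_operator D S" "linear_operator D T"
  shows "linear_operator D (\<lambda>x. S x + c *\<^sub>C T x)"
  using assms unfolding linear_operator_def
  by (auto simp: complex_vector.scale_right_distrib mult.commute)

lemma bounded_clinear_linear_operator:
  assumes "bounded_clinear f" "complex_vector.subspace D"
  shows "linear_operator D f"
  using assms unfolding linear_operator_def bounded_clinear_def
  by (auto simp: linear_simps)

lemma linear_operator_functional_scale:
  fixes f :: "'a::complex_normed_vector \<Rightarrow> complex"
  assumes "linear_operator D f"
  shows "linear_operator D (\<lambda>x. f x *\<^sub>C u)"
  using assms unfolding linear_operator_def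
  by (auto simp: complex_vector.scale_left_distrib scaleC_complex_def)


section \<open>Jordan chains\<close>

text \<open>Every chain is prefixed by \<open>x\<^sub>0 = 0\<close>. With truncated subtraction the equation at \<open>j = 0\<close> is
  trivial, and \<open>\<lambda>j. x (j - s)\<close> is the chain shifted by \<open>s\<close> and padded with zeros.\<close>

definition jordan_chain ::
  "'a::complex_normed_vector set \<Rightarrow> ('a \<Rightarrow> 'b::complex_normed_vector) \<Rightarrow> ('a \<Rightarrow> 'b)
     \<Rightarrow> nat \<Rightarrow> (nat \<Rightarrow> 'a) \<Rightarrow> bool" where
  "jordan_chain D S T k x \<longleftrightarrow> x 0 = 0 \<and> (\<forall>j\<le>k. x j \<in> D \<and> S (x j) = T (x (j - 1)))"

definition chain_ends ::
  "'a::complex_normed_vector set \<Rightarrow> ('a \<Rightarrow> 'b::complex_normed_vector) \<Rightarrow> ('a \<Rightarrow> 'b)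
     \<Rightarrow> nat \<Rightarrow> 'a set" where
  "chain_ends D S T k = {x k |x. jordan_chain D S T k x}"

lemma jordan_chain_zero:
  assumes "linear_operator D S" "linear_operator D T"
  shows "jordan_chain D S T k (\<lambda>_. 0)"
  using assms by (simp add: jordan_chain_def linear_operator_zero
      complex_vector.subspace_0[OF linear_operatorD(1)])

lemma jordan_chain_comb:
  assumes S: "linear_operator D S" and T: "linear_operator D T"
    and x: "jordan_chain D S T k x" and y: "jordan_chain D S T k y"
  shows "jordan_chain D S T k (\<lambda>j. x j + c *\<^sub>C y j)"
proof -
  note D = linear_operatorD(1)[OF S]
  have mem: "c *\<^sub>C y j \<in> D" "x j \<in> D" "y j \<in> D" if "j \<le> k" for j
    using that x y complex_vector.subspace_scale[OF D] by (auto simp: jordan_chain_def)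
  show ?thesis
    unfolding jordan_chain_def
  proof (intro conjI allI impI)
    show "x 0 + c *\<^sub>C y 0 = 0" using x y by (simp add: jordan_chain_def)
    fix j assume j: "j \<le> k"
    show "x j + c *\<^sub>C y j \<in> D" using mem j complex_vector.subspace_add[OF D] by blast
    have "S (x j) = T (x (j - 1))" "S (y j) = T (y (j - 1))"
      using x y j by (auto simp: jordan_chain_def)
    then show "S (x j + c *\<^sub>C y j) = T (x (j - 1) + c *\<^sub>C y (j - 1))"
      using mem[of j] mem[of "j - 1"] j linear_operatorD(2,3)[OF S] linear_operatorD(2,3)[OF T]
      by simp
  qed
qed

lemma jordan_chain_shift:
  assumes "linear_operator D S" "linear_operator D T" "jordan_chain D S T n x" "k \<le> n + s"
  shows "jordan_chain D S T k (\<lambda>j. x (j - s))"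
  using assms(3,4)
  by (auto simp: jordan_chain_def linear_operator_zero[OF assms(1)] linear_operator_zero[OF assms(2)]
       diff_commute)

lemma subspace_chain_ends:
  assumes S: "linear_operator D S" and T: "linear_operator D T"
  shows "complex_vector.subspace (chain_ends D S T k)"
proof (rule complex_vector.subspaceI)
  show "0 \<in> chain_ends D S T k"
    using jordan_chain_zero[OF S T] unfolding chain_ends_def by force
next
  fix x y assume "x \<in> chain_ends D S T k" "y \<in> chain_ends D S T k"
  then obtain a b where ab: "x = a k" "jordan_chain D S T k a" "y = b k" "jordan_chain D S T k b"
    unfolding chain_ends_def by blast
  show "x + y \<in> chain_ends D S T k"
    using jordan_chain_comb[OF S T ab(2,4), of 1] ab unfolding chain_ends_def
    by (auto simp: scaleC_one)
next
  fix x c assume "x \<in> chain_ends D S T k"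
  then obtain a where a: "x = a k" "jordan_chain D S T k a"
    unfolding chain_ends_def by blast
  show "c *\<^sub>C x \<in> chain_ends D S T k"
    using jordan_chain_comb[OF S T jordan_chain_zero[OF S T] a(2), of c] a unfolding chain_ends_def
    by auto
qed

lemma chain_ends_mono:
  assumes "linear_operator D S" "linear_operator D T" "n \<le> k"
  shows "chain_ends D S T n \<subseteq> chain_ends D S T k"
proof
  fix v assume "v \<in> chain_ends D S T n"
  then obtain x where x: "v = x n" "jordan_chain D S T n x" unfolding chain_ends_def by blast
  have "jordan_chain D S T k (\<lambda>j. x (j - (k - n)))"
    using assms x by (intro jordan_chain_shift) auto
  then show "v \<in> chain_ends D S T k" using x(1) assms(3) unfolding chain_ends_def
    by (auto intro!: exI[of _ "\<lambda>j. x (j - (k - n))"])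
qed

lemma root_space_eq_chain_ends:
  assumes A: "linear_operator D A" and E: "linear_operator D E"
  shows "root_space E D A l k = (case l of
      Finite \<mu> \<Rightarrow> chain_ends D (\<lambda>x. A x - \<mu> *\<^sub>C E x) E k | Infinity \<Rightarrow> chain_ends D E A k)"
proof -
  define S where "S = (case l of Finite \<mu> \<Rightarrow> (\<lambda>x. A x - \<mu> *\<^sub>C E x) | Infinity \<Rightarrow> E)"
  define T where "T = (case l of Finite \<mu> \<Rightarrow> E | Infinity \<Rightarrow> A)"
  note [simp] = linear_operator_zero[OF A] linear_operator_zero[OF E]
  have ST0 [simp]: "S 0 = 0" "T 0 = 0" by (auto simp: S_def T_def split: extended_complex.split)
  have D0: "0 \<in> D" by (rule complex_vector.subspace_0[OF linear_operatorD(1)[OF A]])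
  have chain: "root_chain E D A l k x \<longleftrightarrow> (\<forall>j\<in>{1..k}. x j \<in> D \<and>
      S (x j) = (if j = 1 then 0 else T (x (j - 1))))" for x
    unfolding root_chain_def S_def T_def by (cases l) auto
  have "root_space E D A l k = chain_ends D S T k"
  proof (cases "k = 0")
    case True
    then show ?thesis
      using D0 by (auto simp: root_space_def chain_ends_def jordan_chain_def
          intro!: exI[of _ "\<lambda>_. 0"])
  next
    case False
    have to: "jordan_chain D S T k (x(0 := 0))" if "root_chain E D A l k x" for x
      unfolding jordan_chain_def
    proof (intro conjI allI impI)
      fix j assume "j \<le> k"
      then show "(x(0 := 0)) j \<in> D"
        using that D0 unfolding chain by (cases j) auto
      show "S ((x(0 := 0)) j) = T ((x(0 := 0)) (j - 1))"
        using that \<open>j \<le> k\<close> unfolding chain by (cases "j \<le> 1") (auto simp: le_Suc_eq)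
    qed simp
    have "from": "root_chain E D A l k x" if "jordan_chain D S T k x" for x
      using that unfolding chain jordan_chain_def by auto
    show ?thesis
    proof
      show "root_space E D A l k \<subseteq> chain_ends D S T k"
      proof
        fix v assume "v \<in> root_space E D A l k"
        then obtain x where x: "v = x k" "root_chain E D A l k x"
          using False by (auto simp: root_space_def)
        then have "v = (x(0 := 0)) k" using False by simp
        with to[OF x(2)] show "v \<in> chain_ends D S T k" unfolding chain_ends_def by blast
      qed
      show "chain_ends D S T k \<subseteq> root_space E D A l k"
        using "from" False unfolding chain_ends_def root_space_def by auto
    qed
  qed
  then show ?thesis by (cases l) (simp_all add: S_def T_def)
qed


section \<open>Injective pencils\<close>

definition injective_pencil ::
  "'a::complex_normed_vector set \<Rightarrow> ('a \<Rightarrow> 'b::complex_normed_vector) \<Rightarrow> ('a \<Rightarrow> 'b) \<Rightarrow> bool" where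
  "injective_pencil D S T \<longleftrightarrow>
     (\<exists>\<alpha> \<beta>. \<forall>x\<in>D. \<alpha> *\<^sub>C S x + \<beta> *\<^sub>C T x = 0 \<longrightarrow> x = 0)"

text \<open>For a chain that ends in \<open>0\<close>, the polynomial \<open>x(t) = \<Sum>\<^sub>j t\<^sup>j x\<^sub>j\<close> satisfies
  \<open>(S - tT) x(t) = 0\<close>. If \<open>S - rT\<close> is injective, then \<open>x(r)\<close> vanishes, so \<open>x(t)\<close> is divisible by
  \<open>t - r\<close>; the quotient is a shorter polynomial of the same kind, and induction applies. If \<open>T\<close>
  is injective, then already the coefficient before the final \<open>0\<close> vanishes.\<close>

lemma chain_ending_in_zero:
  assumes S: "linear_operator D S" and T: "linear_operator D T"
    and inj: "injective_pencil D S T"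
  shows "jordan_chain D S T n x \<Longrightarrow> x n = 0 \<Longrightarrow> j \<le> n \<Longrightarrow> x j = 0"
proof (induction n arbitrary: x j)
  case 0
  then show ?case by simp
next
  case (Suc n)
  note D = linear_operatorD(1)[OF S]
  note S' = linear_operatorD(2,3)[OF S] and T' = linear_operatorD(2,3)[OF T]
  note z0 = linear_operator_zero[OF S] linear_operator_zero[OF T]
  note mem = complex_vector.subspace_0[OF D] complex_vector.subspace_add[OF D]
    complex_vector.subspace_scale[OF D]
  have x0: "x 0 = 0" and xD: "\<And>j. j \<le> Suc n \<Longrightarrow> x j \<in> D"
    and xch: "\<And>j. j \<le> Suc n \<Longrightarrow> S (x j) = T (x (j - 1))"
    using Suc.prems(1) by (auto simp: jordan_chain_def)
  obtain \<alpha> \<beta> where ab: "\<And>x. x \<in> D \<Longrightarrow> \<alpha> *\<^sub>C S x + \<beta> *\<^sub>C T x = 0 \<Longrightarrow> x = 0"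
    using inj unfolding injective_pencil_def by blast
  show ?case
  proof (cases "\<alpha> = 0")
    case True
    have "T (x n) = 0" using xch[of "Suc n"] Suc.prems(2) z0 by simp
    then have "x n = 0" using ab[of "x n"] xD[of n] True by simp
    moreover have "jordan_chain D S T n x" using Suc.prems(1) by (simp add: jordan_chain_def)
    ultimately show ?thesis
      using Suc.IH[of x j] Suc.prems(2,3) by (cases "j = Suc n") auto
  next
    case False
    define r where "r = - (\<beta> / \<alpha>)"
    have r: "v = 0" if v: "v \<in> D" "S v = r *\<^sub>C T v" for v
    proof -
      have "\<alpha> *\<^sub>C S v = - (\<beta> *\<^sub>C T v)"
        using False v(2) by (simp add: r_def)
      then show ?thesis using ab[OF v(1)] by simp
    qed
    (* Horner's scheme: y lists the coefficients of the quotient x(t) / (t - r), top one first in z *)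
    define z where "z = rec_nat 0 (\<lambda>i u. x (Suc n - i) + r *\<^sub>C u)"
    have z_0: "z 0 = 0" and z_Suc: "\<And>i. z (Suc i) = x (Suc n - i) + r *\<^sub>C z i"
      by (simp_all add: z_def)
    have zD: "z i \<in> D" for i
      by (induction i) (auto simp: z_0 z_Suc mem xD)
    have zS: "S (z i) = T (x (Suc n - i)) + r *\<^sub>C T (z i)" for i
    proof (induction i)
      case 0
      then show ?case using Suc.prems(2) z0 by (simp add: z_0)
    next
      case (Suc i)
      have "S (z (Suc i)) = T (x (Suc n - Suc i)) + r *\<^sub>C S (z i)"
        using xch[of "Suc n - i"] by (simp add: z_Suc S' mem xD zD)
      also have "S (z i) = T (z (Suc i))"
        unfolding Suc.IH by (simp add: z_Suc T' mem xD zD)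
      finally show ?case .
    qed
    define y where "y = (\<lambda>j. z (Suc n - j))"
    have y_rec: "y (j - 1) = x j + r *\<^sub>C y j" if "1 \<le> j" "j \<le> Suc n" for j
    proof -
      have "Suc n - (j - 1) = Suc (Suc n - j)" "Suc n - (Suc n - j) = j" using that by auto
      then show ?thesis by (simp add: y_def z_Suc)
    qed
    have yS: "S (y j) = T (x j) + r *\<^sub>C T (y j)" if "j \<le> Suc n" for j
      using zS[of "Suc n - j"] that by (simp add: y_def)
    have yD: "y j \<in> D" for j by (simp add: y_def zD)
    have y0: "y 0 = 0"
      using yS[of 0] r[OF yD, of 0] x0 z0 by simp
    have yN: "y (Suc n) = 0" by (simp add: y_def z_0)
    have "jordan_chain D S T n y"
      unfolding jordan_chain_def
    proof (intro conjI allI impI)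
      fix j assume j: "j \<le> n"
      show "S (y j) = T (y (j - 1))"
      proof (cases "j = 0")
        case True
        then show ?thesis using y0 z0 by simp
      next
        case False
        then show ?thesis
          using y_rec[of j] yS[of j] j by (simp add: T' mem xD yD)
      qed
    qed (auto simp: y0 yD)
    moreover have "y n = 0" using y_rec[of "Suc n"] Suc.prems(2) yN by simp
    ultimately have y: "y i = 0" if "i \<le> Suc n" for i
      using Suc.IH[of y i] yN that by (cases "i = Suc n") auto
    show ?thesis
    proof (cases "j = 0")
      case False
      then show ?thesis using y_rec[of j] y[of j] y[of "j - 1"] Suc.prems(3) by simp
    qed (simp add: x0)
  qed
qed


section \<open>Rank-one perturbations\<close>

definition rank_one_perturbation ::
  "'a::complex_normed_vector set \<Rightarrow> ('a \<Rightarrow> 'b::complex_normed_vector) \<Rightarrow> ('a \<Rightarrow> 'b)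
     \<Rightarrow> ('a \<Rightarrow> 'b) \<Rightarrow> ('a \<Rightarrow> 'b) \<Rightarrow> bool" where
  "rank_one_perturbation D S T S' T' \<longleftrightarrow>
     (\<exists>f a b. linear_operator D f \<and>
        (\<forall>x\<in>D. S' x = S x + f x *\<^sub>C a \<and> T' x = T x + f x *\<^sub>C b)) \<or>
     (\<exists>f g a. linear_operator D f \<and> linear_operator D g \<and>
        (\<forall>x\<in>D. S' x = S x + f x *\<^sub>C a \<and> T' x = T x + g x *\<^sub>C a))"

lemma rank_one_perturbation_sym:
  assumes "rank_one_perturbation D S T S' T'"
  shows "rank_one_perturbation D S' T' S T"
proof -
  consider (left) f a b where "linear_operator D f"
      "\<forall>x\<in>D. S' x = S x + f x *\<^sub>C a \<and> T' x = T x + f x *\<^sub>C b"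
    | (right) f g a where "linear_operator D f" "linear_operator D g"
      "\<forall>x\<in>D. S' x = S x + f x *\<^sub>C a \<and> T' x = T x + g x *\<^sub>C a"
    using assms unfolding rank_one_perturbation_def by blast
  then show ?thesis
  proof cases
    case left
    then have "\<forall>x\<in>D. S x = S' x + f x *\<^sub>C (- a) \<and> T x = T' x + f x *\<^sub>C (- b)" by simp
    with left(1) show ?thesis unfolding rank_one_perturbation_def by blast
  next
    case right
    then have "\<forall>x\<in>D. S x = S' x + f x *\<^sub>C (- a) \<and> T x = T' x + g x *\<^sub>C (- a)" by simp
    with right(1,2) show ?thesis unfolding rank_one_perturbation_def by blast
  qed
qed

text \<open>A perturbation of either form changes only those chains that violate one scalar condition at
  some index: \<open>f x\<^sub>j = 0\<close> for the first form and \<open>f x\<^sub>j = g x\<^sub>j\<^sub>-\<^sub>1\<close> for the second.\<close>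

lemma rank_one_perturbation_chains:
  assumes pert: "rank_one_perturbation D S T S' T'"
  obtains f g :: "_ \<Rightarrow> complex" where "linear_operator D f" "linear_operator D g"
    "\<And>k x. jordan_chain D S T k x \<Longrightarrow> (\<And>j. j \<le> k \<Longrightarrow> f (x j) = g (x (j - 1)))
       \<Longrightarrow> jordan_chain D S' T' k x"
  using pert unfolding rank_one_perturbation_def
proof (elim disjE exE conjE)
  fix f a b assume f: "linear_operator D f"
    and eq: "\<forall>x\<in>D. S' x = S x + f x *\<^sub>C a \<and> T' x = T x + f x *\<^sub>C b"
  have "linear_operator D (\<lambda>_. 0 :: complex)"
    using linear_operatorD(1)[OF f] by (simp add: linear_operator_def)
  moreover have "jordan_chain D S' T' k x"
    if "jordan_chain D S T k x" "\<And>j. j \<le> k \<Longrightarrow> f (x j) = 0" for k x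
    using that eq by (auto simp: jordan_chain_def)
  ultimately show thesis using f that[of f "\<lambda>_. 0"] by blast
next
  fix f g a assume fg: "linear_operator D f" "linear_operator D g"
    and eq: "\<forall>x\<in>D. S' x = S x + f x *\<^sub>C a \<and> T' x = T x + g x *\<^sub>C a"
  have "jordan_chain D S' T' k x"
    if "jordan_chain D S T k x" "\<And>j. j \<le> k \<Longrightarrow> f (x j) = g (x (j - 1))" for k x
    using that eq by (auto simp: jordan_chain_def)
  then show thesis using fg that[of f g] by blast
qed

text \<open>Pick a chain \<open>q\<close> that violates the scalar conditions at the smallest possible index \<open>p\<close>.
  Subtracting multiples of shifted copies of \<open>q\<close> from a given chain removes its violations one
  after the other. A copy that is shifted by at least one position ends in a shorter chain, so
  modulo the ends of shorter chains only the unshifted copy of \<open>q\<close> counts.\<close>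

lemma unviolated_chains_codim_one:
  assumes S: "linear_operator D S" and T: "linear_operator D T"
    and f: "linear_operator D (f :: _ \<Rightarrow> complex)" and g: "linear_operator D (g :: _ \<Rightarrow> complex)"
  obtains p where "\<And>v. v \<in> chain_ends D S T k \<Longrightarrow>
    \<exists>y t. jordan_chain D S T k y \<and> (\<forall>j\<le>k. f (y j) = g (y (j - 1))) \<and>
      v - y k - t *\<^sub>C p \<in> chain_ends D S T (k - 1)"
proof -
  define U where "U = chain_ends D S T (k - 1)"
  have U: "complex_vector.subspace U"
    unfolding U_def by (rule subspace_chain_ends[OF S T])
  define \<phi> where "\<phi> = (\<lambda>x (j :: nat). f (x j) - g (x (j - 1)))"
  define bad where "bad = (\<lambda>p. \<exists>q. jordan_chain D S T k q \<and> p \<le> k \<and> \<phi> q p \<noteq> 0)"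
  note f' = linear_operatorD(2,3)[OF f] and g' = linear_operatorD(2,3)[OF g]
  have \<phi>_comb: "\<phi> (\<lambda>j. x j + c *\<^sub>C y j) j = \<phi> x j + c * \<phi> y j"
    if "jordan_chain D S T k x" "jordan_chain D S T k y" "j \<le> k" for x y c j
  proof -
    have "x i \<in> D" "y i \<in> D" "c *\<^sub>C y i \<in> D" if "i \<le> k" for i
      using \<open>jordan_chain D S T k x\<close> \<open>jordan_chain D S T k y\<close> that
        complex_vector.subspace_scale[OF linear_operatorD(1)[OF S]]
      by (auto simp: jordan_chain_def)
    then show ?thesis using that(3)
      by (simp add: \<phi>_def f' g' scaleC_complex_def algebra_simps)
  qed
  show thesis
  proof (cases "\<exists>p. bad p")
    case False
    have "\<exists>y t. jordan_chain D S T k y \<and> (\<forall>j\<le>k. f (y j) = g (y (j - 1))) \<and>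
        v - y k - t *\<^sub>C 0 \<in> U" if v: "v \<in> chain_ends D S T k" for v
    proof -
      obtain y where "jordan_chain D S T k y" "v = y k"
        using v unfolding chain_ends_def by blast
      then show ?thesis using False complex_vector.subspace_0[OF U]
        by (intro exI[of _ y]) (auto simp: bad_def \<phi>_def)
    qed
    then show thesis using that[of 0] unfolding U_def by blast
  next
    case True
    define p where "p = (LEAST p. bad p)"
    have "bad p" unfolding p_def using True by (auto intro: LeastI)
    then obtain q where q: "jordan_chain D S T k q" "\<phi> q p \<noteq> 0" "p \<le> k"
      unfolding bad_def by blast
    have min: "\<phi> y j = 0" if "jordan_chain D S T k y" "j \<le> k" "j < p" for y j
      using not_less_Least[of j bad] that unfolding p_def bad_def by blast
    have \<phi>0: "\<phi> y 0 = 0" if "jordan_chain D S T k y" for y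
      using that linear_operator_zero[OF f] linear_operator_zero[OF g]
      by (simp add: jordan_chain_def \<phi>_def)
    have step: "\<exists>y t. jordan_chain D S T k y \<and> (\<forall>j\<le>m. \<phi> y j = 0) \<and> x k - y k - t *\<^sub>C q k \<in> U"
      if x: "jordan_chain D S T k x" and "m \<le> k" for x m
      using \<open>m \<le> k\<close>
    proof (induction m)
      case 0
      then show ?case using x \<phi>0 complex_vector.subspace_0[OF U]
        by (intro exI[of _ x] exI[of _ 0]) auto
    next
      case (Suc m)
      then obtain y t where y: "jordan_chain D S T k y" "\<forall>j\<le>m. \<phi> y j = 0"
        "x k - y k - t *\<^sub>C q k \<in> U" by auto
      show ?case
      proof (cases "Suc m < p")
        case True
        then have "\<forall>j\<le>Suc m. \<phi> y j = 0" using y min[OF y(1)] Suc.prems by simp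
        with y show ?thesis by blast
      next
        case False
        define s where "s = Suc m - p"
        define h where "h = (\<lambda>j. q (j - s))"
        define c where "c = - (\<phi> y (Suc m) / \<phi> q p)"
        have h: "jordan_chain D S T k h"
          unfolding h_def using q(1) by (intro jordan_chain_shift[OF S T]) auto
        have \<phi>h: "\<phi> h j = \<phi> q (j - s)" for j by (simp add: h_def \<phi>_def diff_commute)
        define y' where "y' = (\<lambda>j. y j + c *\<^sub>C h j)"
        have y': "jordan_chain D S T k y'"
          unfolding y'_def by (rule jordan_chain_comb[OF S T y(1) h])
        have "\<phi> y' j = 0" if "j \<le> Suc m" for j
        proof -
          have eq: "\<phi> y' j = \<phi> y j + c * \<phi> q (j - s)"
            unfolding y'_def using \<phi>_comb[OF y(1) h] that Suc.prems \<phi>h by simp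
          show ?thesis
          proof (cases "j = Suc m")
            case True
            then have "j - s = p" using False by (simp add: s_def)
            then show ?thesis using eq True q(2) by (simp add: c_def)
          next
            case jm: False
            then have "\<phi> q (j - s) = 0"
              using that False Suc.prems \<phi>0[OF q(1)]
              by (cases "j \<le> s") (auto intro!: min[OF q(1)] simp: s_def)
            then show ?thesis using eq y(2) that jm by simp
          qed
        qed
        moreover have "\<exists>t'. x k - y' k - t' *\<^sub>C q k \<in> U"
        proof (cases "s = 0")
          case True
          have "x k - y' k - (t - c) *\<^sub>C q k = x k - y k - t *\<^sub>C q k"
            by (simp add: y'_def h_def True complex_vector.scale_left_diff_distrib)
          then show ?thesis using y(3) by metis
        next
          case False
          have "jordan_chain D S T (k - 1) (\<lambda>j. q (j - (s - 1)))"
            using q(1) by (intro jordan_chain_shift[OF S T q(1)]) auto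
          moreover have "h k = q (k - 1 - (s - 1))" using False by (simp add: h_def)
          ultimately have "h k \<in> U"
            unfolding U_def chain_ends_def mem_Collect_eq by (intro exI[of _ "\<lambda>j. q (j - (s - 1))"] conjI)
          then have "x k - y k - t *\<^sub>C q k - c *\<^sub>C h k \<in> U"
            using y(3) U complex_vector.subspace_diff complex_vector.subspace_scale by blast
          moreover have "x k - y k - t *\<^sub>C q k - c *\<^sub>C h k = x k - y' k - t *\<^sub>C q k"
            by (simp add: y'_def)
          ultimately show ?thesis by metis
        qed
        ultimately show ?thesis using y' by blast
      qed
    qed
    have "\<exists>y t. jordan_chain D S T k y \<and> (\<forall>j\<le>k. f (y j) = g (y (j - 1))) \<and>
        v - y k - t *\<^sub>C q k \<in> U" if v: "v \<in> chain_ends D S T k" for v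
    proof -
      obtain x where "jordan_chain D S T k x" "v = x k"
        using v unfolding chain_ends_def by blast
      then show ?thesis using step[of x k] by (auto simp: \<phi>_def)
    qed
    then show thesis using that unfolding U_def by blast
  qed
qed

text \<open>Let \<open>C\<close> consist of the ends of the common chains of both pencils. If the end of a common chain
  \<open>z\<close> is also the end of a shorter chain \<open>w\<close> of the perturbed pencil, then the difference of \<open>z\<close> and
  the shifted \<open>w\<close> is a chain of the perturbed pencil that ends in \<open>0\<close> and starts with \<open>z\<^sub>1\<close>. So
  \<open>z\<^sub>1 = 0\<close>, and dropping it leaves a shorter chain of the original pencil with the same end.\<close>

lemma chain_ends_quotient_dim_le:
  assumes S: "linear_operator D S" and T: "linear_operator D T"
    and S': "linear_operator D S'" and T': "linear_operator D T'"
    and pert: "rank_one_perturbation D S T S' T'" and inj: "injective_pencil D S' T'"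
  shows "quotient_dim (chain_ends D S T k) (chain_ends D S T (k - 1))
       \<le> quotient_dim (chain_ends D S' T' k) (chain_ends D S' T' (k - 1)) + 1"
proof -
  obtain f g :: "_ \<Rightarrow> complex" where fg: "linear_operator D f" "linear_operator D g"
    and same: "\<And>k x. jordan_chain D S T k x \<Longrightarrow> (\<And>j. j \<le> k \<Longrightarrow> f (x j) = g (x (j - 1)))
       \<Longrightarrow> jordan_chain D S' T' k x"
    by (rule rank_one_perturbation_chains[OF pert]) blast
  define C where "C = {x k |x. jordan_chain D S T k x \<and> jordan_chain D S' T' k x}"
  obtain p where p: "\<And>v. v \<in> chain_ends D S T k \<Longrightarrow>
    \<exists>y t. jordan_chain D S T k y \<and> (\<forall>j\<le>k. f (y j) = g (y (j - 1))) \<and>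
      v - y k - t *\<^sub>C p \<in> chain_ends D S T (k - 1)"
    using unviolated_chains_codim_one[OF S T fg] by blast
  show ?thesis
  proof (rule quotient_dim_le_Suc[where C = C and p = p])
    show "complex_vector.subspace C"
    proof (rule complex_vector.subspaceI)
      show "0 \<in> C"
        using jordan_chain_zero[OF S T] jordan_chain_zero[OF S' T'] unfolding C_def by force
    next
      fix x y assume "x \<in> C" "y \<in> C"
      then obtain a b where ab: "x = a k" "y = b k"
        "jordan_chain D S T k a" "jordan_chain D S T k b"
        "jordan_chain D S' T' k a" "jordan_chain D S' T' k b"
        unfolding C_def by blast
      show "x + y \<in> C"
        using jordan_chain_comb[OF S T ab(3,4), of 1] jordan_chain_comb[OF S' T' ab(5,6), of 1] ab
        unfolding C_def by (auto simp: scaleC_one)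
    next
      fix x c assume "x \<in> C"
      then obtain a where a: "x = a k" "jordan_chain D S T k a" "jordan_chain D S' T' k a"
        unfolding C_def by blast
      show "c *\<^sub>C x \<in> C"
        using jordan_chain_comb[OF S T jordan_chain_zero[OF S T] a(2), of c]
          jordan_chain_comb[OF S' T' jordan_chain_zero[OF S' T'] a(3), of c] a
        unfolding C_def by auto
    qed
    show "C \<inter> chain_ends D S' T' (k - 1) \<subseteq> chain_ends D S T (k - 1)"
    proof
      fix v assume "v \<in> C \<inter> chain_ends D S' T' (k - 1)"
      then obtain z w where z: "v = z k" "jordan_chain D S T k z" "jordan_chain D S' T' k z"
        and w: "v = w (k - 1)" "jordan_chain D S' T' (k - 1) w"
        unfolding C_def chain_ends_def by blast
      have "jordan_chain D S' T' k (\<lambda>j. w (j - 1))"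
        using w(2) by (intro jordan_chain_shift[OF S' T']) auto
      then have "jordan_chain D S' T' k (\<lambda>j. z j + (-1) *\<^sub>C w (j - 1))"
        by (intro jordan_chain_comb[OF S' T' z(3)])
      from chain_ending_in_zero[OF S' T' inj this, of 1] w(1) z(1)
      have z1: "z 1 = 0" if "k \<ge> 1"
        using that w(2) by (simp add: jordan_chain_def scaleC_one)
      show "v \<in> chain_ends D S T (k - 1)"
      proof (cases "k = 0")
        case True
        then show ?thesis using z unfolding chain_ends_def by auto
      next
        case False
        have "jordan_chain D S T (k - 1) (\<lambda>j. z (Suc j))"
          unfolding jordan_chain_def
        proof (intro conjI allI impI)
          show "z (Suc 0) = 0" using z1 False by simp
          fix j assume j: "j \<le> k - 1"
          then have jk: "Suc j \<le> k" using False by simp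
          show "z (Suc j) \<in> D" using z(2) jk by (simp add: jordan_chain_def)
          have "S (z (Suc j)) = T (z j)" using z(2) jk unfolding jordan_chain_def by force
          then show "S (z (Suc j)) = T (z (Suc (j - 1)))"
            using z1 z(2) jk by (cases j) (auto simp: jordan_chain_def)
        qed
        then show ?thesis using z(1) False unfolding chain_ends_def
          by (auto intro!: exI[of _ "\<lambda>j. z (Suc j)"])
      qed
    qed
    show "\<exists>c\<in>C. \<exists>t. v - c - t *\<^sub>C p \<in> chain_ends D S T (k - 1)" if "v \<in> chain_ends D S T k" for v
      using p[OF that] same unfolding C_def by blast
    show "C \<subseteq> chain_ends D S' T' k" "C \<subseteq> chain_ends D S T k"
      by (auto simp: C_def chain_ends_def)
  qed (simp_all add: S T S' T' subspace_chain_ends chain_ends_mono)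
qed


section \<open>The pencils \<open>\<lambda>E - A\<close>\<close>

lemma edim_root_space_Suc:
  assumes "linear_operator D A" "linear_operator D E"
  shows "edim (root_space E D A l (Suc n)) = edim (root_space E D A l n) + weyr E D A l (Suc n)"
proof -
  have "linear_operator D (\<lambda>x. A x - \<mu> *\<^sub>C E x)" for \<mu>
    using linear_operator_comb[OF assms, of "- \<mu>"] by simp
  then show ?thesis
    unfolding weyr_def using assms
    by (auto simp: root_space_eq_chain_ends[OF assms] split: extended_complex.split
        intro!: edim_eq_edim_add_quotient_dim subspace_chain_ends
        intro: chain_ends_mono[THEN subsetD, rotated -1])
qed

lemma weyr_rank_one_perturbation_le:
  assumes lin: "linear_operator D A" "linear_operator D E" "linear_operator D A'" "linear_operator D E'"
    and pert: "rank_one_perturbation D E A E' A'" and inj: "injective_pencil D E' A'"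
  shows "weyr E D A l k \<le> weyr E' D A' l k + 1"
proof (cases l)
  case Infinity
  then show ?thesis
    using chain_ends_quotient_dim_le[OF lin(2,1,4,3) pert inj]
    by (simp add: weyr_def root_space_eq_chain_ends lin)
next
  case (Finite \<mu>)
  have linS: "linear_operator D (\<lambda>x. A x - \<mu> *\<^sub>C E x)" "linear_operator D (\<lambda>x. A' x - \<mu> *\<^sub>C E' x)"
    using linear_operator_comb[OF lin(1,2), of "- \<mu>"] linear_operator_comb[OF lin(3,4), of "- \<mu>"]
    by simp_all
  have "rank_one_perturbation D (\<lambda>x. A x - \<mu> *\<^sub>C E x) E (\<lambda>x. A' x - \<mu> *\<^sub>C E' x) E'"
  proof -
    consider (left) f a b where "linear_operator D f"
        "\<forall>x\<in>D. E' x = E x + f x *\<^sub>C a \<and> A' x = A x + f x *\<^sub>C b"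
      | (right) f g a where "linear_operator D f" "linear_operator D g"
        "\<forall>x\<in>D. E' x = E x + f x *\<^sub>C a \<and> A' x = A x + g x *\<^sub>C a"
      using pert unfolding rank_one_perturbation_def by blast
    then show ?thesis
    proof cases
      case left
      then have "\<forall>x\<in>D. A' x - \<mu> *\<^sub>C E' x = A x - \<mu> *\<^sub>C E x + f x *\<^sub>C (b - \<mu> *\<^sub>C a) \<and>
          E' x = E x + f x *\<^sub>C a"
        by (simp add: complex_vector.scale_right_distrib complex_vector.scale_right_diff_distrib
            mult.commute)
      with left(1) show ?thesis unfolding rank_one_perturbation_def by blast
    next
      case right
      have h: "linear_operator D (\<lambda>x. g x - \<mu> * f x)"
        using linear_operator_comb[OF right(2,1), of "- \<mu>"] by (simp add: scaleC_complex_def)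
      from right have "\<forall>x\<in>D. A' x - \<mu> *\<^sub>C E' x = A x - \<mu> *\<^sub>C E x + (g x - \<mu> * f x) *\<^sub>C a \<and>
          E' x = E x + f x *\<^sub>C a"
        by (simp add: complex_vector.scale_right_distrib complex_vector.scale_left_diff_distrib)
      with right(1) h show ?thesis unfolding rank_one_perturbation_def by blast
    qed
  qed
  moreover have "injective_pencil D (\<lambda>x. A' x - \<mu> *\<^sub>C E' x) E'"
  proof -
    obtain \<alpha> \<beta> where ab: "\<forall>x\<in>D. \<alpha> *\<^sub>C E' x + \<beta> *\<^sub>C A' x = 0 \<longrightarrow> x = 0"
      using inj unfolding injective_pencil_def by blast
    have "\<beta> *\<^sub>C (A' x - \<mu> *\<^sub>C E' x) + (\<alpha> + \<beta> * \<mu>) *\<^sub>C E' x = \<alpha> *\<^sub>C E' x + \<beta> *\<^sub>C A' x" for x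
      by (simp add: complex_vector.scale_right_diff_distrib complex_vector.scale_left_distrib)
    with ab have "\<forall>x\<in>D. \<beta> *\<^sub>C (A' x - \<mu> *\<^sub>C E' x) + (\<alpha> + \<beta> * \<mu>) *\<^sub>C E' x = 0 \<longrightarrow> x = 0"
      by simp
    then show ?thesis unfolding injective_pencil_def by blast
  qed
  ultimately show ?thesis
    using Finite chain_ends_quotient_dim_le[OF linS(1) lin(2) linS(2) lin(4)]
    by (simp add: weyr_def root_space_eq_chain_ends lin)
qed

lemma edim_root_space_rank_one_perturbation_le:
  assumes lin: "linear_operator D A" "linear_operator D E" "linear_operator D A'" "linear_operator D E'"
    and pert: "rank_one_perturbation D E A E' A'" and inj: "injective_pencil D E' A'"
  shows "edim (root_space E D A l k) \<le> edim (root_space E' D A' l k) + enat k"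
proof (induction k)
  case 0
  then show ?case by (simp add: root_space_def)
next
  case (Suc k)
  have "edim (root_space E D A l (Suc k)) = edim (root_space E D A l k) + weyr E D A l (Suc k)"
    by (rule edim_root_space_Suc[OF lin(1,2)])
  also have "\<dots> \<le> (edim (root_space E' D A' l k) + enat k) + (weyr E' D A' l (Suc k) + 1)"
    by (intro add_mono Suc.IH weyr_rank_one_perturbation_le[OF lin pert inj])
  also have "\<dots> = edim (root_space E' D A' l (Suc k)) + (enat k + 1)"
    unfolding edim_root_space_Suc[OF lin(3,4)] by (simp only: add_ac)
  also have "enat k + 1 = enat (Suc k)" by (simp add: one_enat_def)
  finally show ?case .
qed

theorem theorem5p5:
  fixes E Eh A Ah :: "'a::complex_banach \<Rightarrow> 'b::complex_banach"
    and D :: "'a set" and k :: nat and l :: extended_complex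
  assumes E: "bounded_clinear E"
    and A: "linear_operator D A" "closed_operator D A" "densely_defined D"
    and bij: "\<exists>\<mu>. bij_betw (\<lambda>x. \<mu> *\<^sub>C E x - A x) D UNIV"
    and perturbation:
      "(\<exists>u w v. bounded_clinear v \<and>
          (\<forall>x. Eh x = E x + v x *\<^sub>C u) \<and> (\<forall>x\<in>D. Ah x = A x + v x *\<^sub>C w)) \<or>
       (\<exists>u v w. bounded_clinear v \<and> bounded_clinear w \<and>
          (\<forall>x. Eh x = E x + v x *\<^sub>C u) \<and> (\<forall>x\<in>D. Ah x = A x + w x *\<^sub>C u))"
    and regular: "regular_pencil Eh D Ah"
    and k: "k \<ge> 1"
    and finite_weyr: "weyr E D A l k \<noteq> \<infinity>"
  shows "(weyr Eh D Ah l k \<le> weyr E D A l k + 1 \<and>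
          weyr E D A l k \<le> weyr Eh D Ah l k + 1) \<and>
         (edim (root_space Eh D Ah l k) \<le> edim (root_space E D A l k) + enat k \<and>
          edim (root_space E D A l k) \<le> edim (root_space Eh D Ah l k) + enat k)"
proof -
  note D = linear_operatorD(1)[OF A(1)]
  note functional = bounded_clinear_linear_operator[OF _ D]
  have linE: "linear_operator D E" by (rule functional[OF E])
  have pert: "rank_one_perturbation D E A Eh Ah"
    using perturbation functional unfolding rank_one_perturbation_def by meson
  have linh: "linear_operator D Ah" "linear_operator D Eh"
  proof -
    obtain f g a b where fg: "linear_operator D f" "linear_operator D g"
      "\<forall>x\<in>D. Eh x = E x + f x *\<^sub>C a \<and> Ah x = A x + g x *\<^sub>C b"
      using pert unfolding rank_one_perturbation_def by metis
    have *: "linear_operator D h" if "linear_operator D h'" "\<And>x. x \<in> D \<Longrightarrow> h x = h' x" for h h' :: "'a \<Rightarrow> 'b"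
      using that D unfolding linear_operator_def
      by (simp add: complex_vector.subspace_add complex_vector.subspace_scale)
    show "linear_operator D Ah" "linear_operator D Eh"
      using *[OF linear_operator_comb[OF A(1) linear_operator_functional_scale[OF fg(2), of b], of 1]]
        *[OF linear_operator_comb[OF linE linear_operator_functional_scale[OF fg(1), of a], of 1]] fg(3)
      by (auto simp: scaleC_one)
  qed
  have inj: "injective_pencil D F B" if "inj_on (\<lambda>x. \<mu> *\<^sub>C F x - B x) D"
    "linear_operator D F" "linear_operator D B" for F B :: "'a \<Rightarrow> 'b" and \<mu>
  proof -
    have "\<forall>x\<in>D. \<mu> *\<^sub>C F x + (-1) *\<^sub>C B x = 0 \<longrightarrow> x = 0"
      using inj_onD[OF that(1) _ _ complex_vector.subspace_0[OF D]]
        linear_operator_zero[OF that(2)] linear_operator_zero[OF that(3)]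
      by (simp add: scaleC_one)
    then show ?thesis unfolding injective_pencil_def by blast
  qed
  have injE: "injective_pencil D E A"
    using bij inj linE A(1) by (auto dest: bij_betw_imp_inj_on)
  obtain r where r: "resolvent_point Eh D Ah r" using regular unfolding regular_pencil_def by blast
  have injh: "injective_pencil D Eh Ah"
  proof (cases r)
    case (Finite \<mu>)
    then show ?thesis using r inj linh by (auto simp: resolvent_point_def dest: bij_betw_imp_inj_on)
  next
    case Infinity
    then have "inj Eh" using r by (auto simp: resolvent_point_def bij_is_inj)
    then have "\<forall>x\<in>D. 1 *\<^sub>C Eh x + 0 *\<^sub>C Ah x = 0 \<longrightarrow> x = 0"
      using linear_operator_zero[OF linh(2)] injD[of Eh _ 0] by (simp add: scaleC_one)
    then show ?thesis unfolding injective_pencil_def by blast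
  qed
  note pert' = rank_one_perturbation_sym[OF pert]
  show ?thesis
    using weyr_rank_one_perturbation_le[OF A(1) linE linh pert injh]
      weyr_rank_one_perturbation_le[OF linh A(1) linE pert' injE]
      edim_root_space_rank_one_perturbation_le[OF A(1) linE linh pert injh]
      edim_root_space_rank_one_perturbation_le[OF linh A(1) linE pert' injE]
    by blast
qed

end
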